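(* Let $(\mathcal{A},\varepsilon)$ be a full-dimensional signed support in $\mathbb{R}^2$, with Gale dual matrix $B$, and assume that both $\mathcal{A}_+$ and $\mathcal{A}_-$ have a pair of strict enclosing hyperplanes. Then: (i) for every $c\in\mathbb{R}^{\mathcal{A}}_\varepsilon$ and every $x\in\operatorname{Sing}(f_c)$, the Hessian matrix $\operatorname{Hess}_{f_c}(x)$ has a positive and a negative eigenvalue; (ii) if $\mathcal{A}$ consists of $5$ exponent vectors, then the complement $\mathbb{R}^2\setminus\Gamma_\varepsilon(A,B)$ of the signed reduced $A$-discriminant consists of at most two connected components.
   Context: A signed support $(\mathcal{A},\varepsilon)$ in $\mathbb{R}^n$ (here $n=2$) consists of a finite set $\mathcal{A}=\{\alpha_1,\dots,\alpha_{n+k+1}\}\subseteq\mathbb{R}^n$ of (distinct) exponent vectors and a sign distribution $\varepsilon\in\{\pm1\}^{n+k+1}$; it is full-dimensional if $\dim\operatorname{Conv}(\mathcal{A})=n$. Put $\mathcal{A}_+=\{\alpha_i:\varepsilon_i=1\}$, $\mathcal{A}_-=\{\alpha_i:\varepsilon_i=-1\}$ and $\mathbb{R}^{\mathcal{A}}_\varepsilon=\{c\in\mathbb{R}^{n+k+1}:\operatorname{sign}(c)=\varepsilon\}$. For $c\in\mathbb{R}^{\mathcal{A}}_\varepsilon$ let $f_c(x)=\sum_i c_i e^{\alpha_i\cdot x}$ on $\mathbb{R}^n$, and let $\operatorname{Sing}(f_c)$ be the set of $x\in\mathbb{R}^n$ at which $f_c$ and all its first partial derivatives vanish. Let $\nabla_{\mathcal{A},\varepsilon}=\{c\in\mathbb{R}^{\mathcal{A}}_\varepsilon:\operatorname{Sing}(f_c)\ne\emptyset\}$.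 Let $\hat A\in\mathbb{R}^{(n+1)\times(n+k+1)}$ have $i$-th column $(1,\alpha_i)^\top$. A Gale dual matrix $B$ of $\mathcal{A}$ is a matrix in $\mathbb{R}^{(n+k+1)\times k}$ whose columns form a basis of $\ker(\hat A)$. The signed reduced $A$-discriminant is $\Gamma_\varepsilon(A,B)=\{B^\top\operatorname{Log}|c|:c\in\nabla_{\mathcal{A},\varepsilon}\}\subseteq\mathbb{R}^k$ (coordinate-wise absolute value and natural logarithm). For $v\in\mathbb{R}^n\setminus\{0\}$, $a\in\mathbb{R}$ let $\mathcal{H}_{v,a}=\{\mu:v\cdot\mu=a\}$, $\mathcal{H}^+_{v,a}=\{\mu:v\cdot\mu\ge a\}$, $\mathcal{H}^-_{v,a}=\{\mu:v\cdot\mu\le a\}$. A pair of parallel hyperplanes $\mathcal{H}_{v,a},\mathcal{H}_{v,b}$ with $a\ge b$ is a pair of enclosing hyperplanes of $\mathcal{A}_+$ if $\mathcal{A}_+\subseteq\mathcal{H}^-_{v,a}\cap\mathcal{H}^+_{v,b}$ and $\mathcal{A}_-\subseteq\mathbb{R}^n\setminus(\operatorname{int}(\mathcal{H}^-_{v,a})\cap\operatorname{int}(\mathcal{H}^+_{v,b}))$; it is strict if additionally $\operatorname{int}(\mathcal{H}^+_{v,a})\cap\mathcal{A}_-\ne\emptyset$ and $\operatorname{int}(\mathcal{H}^-_{v,b})\cap\mathcal{A}_-\ne\emptyset$. Strict enclosing hyperplanes of $\mathcal{A}_-$ are defined in the same way with the roles of $\mathcal{A}_+$ and $\mathcal{A}_-$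 exchanged. *)

theory Defs
  imports "HOL-Analysis.Analysis"
begin

section \<open>Signed supports\<close>

text \<open>
  The exponent vectors are an injective family indexed by a finite type \<open>'m\<close>, so that the support
  is \<open>range \<alpha>\<close>; coefficient vectors live in \<open>real^'m\<close>.
\<close>

definition signed_support :: "('m::finite \<Rightarrow> real^'n::finite) \<Rightarrow> ('m \<Rightarrow> real) \<Rightarrow> bool" where
  "signed_support \<alpha> \<epsilon> \<longleftrightarrow> inj \<alpha> \<and> (\<forall>i. \<epsilon> i \<in> {-1, 1})"

definition full_dimensional :: "('m::finite \<Rightarrow> real^'n::finite) \<Rightarrow> bool" where
  "full_dimensional \<alpha> \<longleftrightarrow> aff_dim (convex hull (range \<alpha>)) = int CARD('n)"

definition pos_support :: "('m::finite \<Rightarrow> real^'n::finite) \<Rightarrow> ('m \<Rightarrow> real) \<Rightarrow> (real^'n) set" where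
  "pos_support \<alpha> \<epsilon> = {\<alpha> i | i. \<epsilon> i = 1}"

definition neg_support :: "('m::finite \<Rightarrow> real^'n::finite) \<Rightarrow> ('m \<Rightarrow> real) \<Rightarrow> (real^'n) set" where
  "neg_support \<alpha> \<epsilon> = {\<alpha> i | i. \<epsilon> i = -1}"

definition coeff_orthant :: "('m::finite \<Rightarrow> real) \<Rightarrow> (real^'m) set" where
  "coeff_orthant \<epsilon> = {c. \<forall>i. sgn (c $ i) = \<epsilon> i}"


section \<open>Exponential sums, singular points and Hessians\<close>

definition exp_sum :: "('m::finite \<Rightarrow> real^'n::finite) \<Rightarrow> real^'m \<Rightarrow> real^'n \<Rightarrow> real" where
  "exp_sum \<alpha> c x = (\<Sum>i\<in>UNIV. c $ i * exp (\<alpha> i \<bullet> x))"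

definition partial_deriv :: "'n::finite \<Rightarrow> (real^'n \<Rightarrow> real) \<Rightarrow> real^'n \<Rightarrow> real" where
  "partial_deriv j f x = deriv (\<lambda>t. f (x + t *\<^sub>R axis j 1)) 0"

definition sing :: "(real^'n::finite \<Rightarrow> real) \<Rightarrow> (real^'n) set" where
  "sing f = {x. f x = 0 \<and> (\<forall>j. partial_deriv j f x = 0)}"

definition hessian :: "(real^'n::finite \<Rightarrow> real) \<Rightarrow> real^'n \<Rightarrow> real^'n^'n" where
  "hessian f x = (\<chi> i j. partial_deriv i (partial_deriv j f) x)"

definition eigenvalue :: "real^'n::finite^'n \<Rightarrow> real \<Rightarrow> bool" where
  "eigenvalue M l \<longleftrightarrow> (\<exists>v. v \<noteq> 0 \<and> M *v v = l *\<^sub>R v)"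


section \<open>Gale duality and the signed reduced discriminant\<close>

definition signed_discriminant ::
    "('m::finite \<Rightarrow> real^'n::finite) \<Rightarrow> ('m \<Rightarrow> real) \<Rightarrow> (real^'m) set" where
  "signed_discriminant \<alpha> \<epsilon> = {c \<in> coeff_orthant \<epsilon>. sing (exp_sum \<alpha> c) \<noteq> {}}"

text \<open>The rows are indexed by \<open>'n option\<close>: \<open>None\<close> is the additional row of ones.\<close>

definition A_hat :: "('m::finite \<Rightarrow> real^'n::finite) \<Rightarrow> real^'m^('n option)" where
  "A_hat \<alpha> = (\<chi> r i. case r of None \<Rightarrow> 1 | Some j \<Rightarrow> \<alpha> i $ j)"

text \<open>
  The cardinality condition says that \<open>B\<close> has \<open>k\<close> columns when the support has \<open>n + k + 1\<close> elements.
  Injectivity is required because independence of the set of columns does not exclude repeated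
  columns.
\<close>

definition gale_dual :: "('m::finite \<Rightarrow> real^'n::finite) \<Rightarrow> real^'k::finite^'m \<Rightarrow> bool" where
  "gale_dual \<alpha> B \<longleftrightarrow>
     CARD('m) = CARD('n) + CARD('k) + 1 \<and>
     inj (\<lambda>j. column j B) \<and> independent (columns B) \<and>
     span (columns B) = {w. A_hat \<alpha> *v w = 0}"

definition log_abs :: "real^'m::finite \<Rightarrow> real^'m" where
  "log_abs c = (\<chi> i. ln \<bar>c $ i\<bar>)"

definition signed_reduced_discriminant ::
    "('m::finite \<Rightarrow> real^'n::finite) \<Rightarrow> ('m \<Rightarrow> real) \<Rightarrow> real^'k::finite^'m \<Rightarrow> (real^'k) set" where
  "signed_reduced_discriminant \<alpha> \<epsilon> B =
     {transpose B *v log_abs c | c. c \<in> signed_discriminant \<alpha> \<epsilon>}"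


section \<open>Enclosing hyperplanes\<close>

definition halfspace_ge :: "real^'n::finite \<Rightarrow> real \<Rightarrow> (real^'n) set" where
  "halfspace_ge v a = {\<mu>. v \<bullet> \<mu> \<ge> a}"

definition halfspace_le :: "real^'n::finite \<Rightarrow> real \<Rightarrow> (real^'n) set" where
  "halfspace_le v a = {\<mu>. v \<bullet> \<mu> \<le> a}"

text \<open>
  The parallel hyperplanes \<open>v \<bullet> \<mu> = a\<close> and \<open>v \<bullet> \<mu> = b\<close> enclose \<open>P\<close> and leave no point of \<open>N\<close> strictly
  between them.
\<close>

definition enclosing_hyperplanes ::
    "real^'n::finite \<Rightarrow> real \<Rightarrow> real \<Rightarrow> (real^'n) set \<Rightarrow> (real^'n) set \<Rightarrow> bool" where
  "enclosing_hyperplanes v a b P N \<longleftrightarrow>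
     v \<noteq> 0 \<and> a \<ge> b \<and>
     P \<subseteq> halfspace_le v a \<inter> halfspace_ge v b \<and>
     N \<subseteq> UNIV - (interior (halfspace_le v a) \<inter> interior (halfspace_ge v b))"

definition strict_enclosing_hyperplanes ::
    "real^'n::finite \<Rightarrow> real \<Rightarrow> real \<Rightarrow> (real^'n) set \<Rightarrow> (real^'n) set \<Rightarrow> bool" where
  "strict_enclosing_hyperplanes v a b P N \<longleftrightarrow>
     enclosing_hyperplanes v a b P N \<and>
     interior (halfspace_ge v a) \<inter> N \<noteq> {} \<and>
     interior (halfspace_le v b) \<inter> N \<noteq> {}"

end

theory Submission
  imports Defs
begin

text \<open>
  At a singular point \<open>x\<close> of \<open>f = exp_sum \<alpha> c\<close> the terms \<open>w i = c i * exp (\<alpha> i \<bullet> x)\<close> satisfy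
  \<open>(\<Sum>i. w i) = 0\<close> and \<open>(\<Sum>i. w i *\<^sub>R \<alpha> i) = 0\<close>, and the Hessian \<open>H\<close> has the quadratic form
  \<open>v \<mapsto> \<Sum>i. w i * (v \<bullet> \<alpha> i)\<^sup>2\<close>. If hyperplanes \<open>v \<bullet> \<mu> = a\<close> and \<open>v \<bullet> \<mu> = b\<close> strictly enclose the
  positive points, the two relations turn the value at \<open>v\<close> into
  \<open>\<Sum>i. w i * (v \<bullet> \<alpha> i - a) * (v \<bullet> \<alpha> i - b)\<close>, where no summand is positive and some are negative.
  Hyperplanes enclosing the negative points give a positive value in the same way. So \<open>H\<close> is
  indefinite, and in the plane this means \<open>det H < 0\<close> (\<open>second_moment_det_neg\<close>): the eigenvalues have
  opposite signs, and \<open>H\<close> is nonsingular.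

  For five points the relations form a plane, the range of \<open>B\<close>. Since \<open>B\<^sup>T\<close> annihilates the vectors
  \<open>i \<mapsto> \<alpha> i \<bullet> x\<close> and the constant ones, the reduced discriminant is the image of the relations with
  sign vector \<open>\<epsilon>\<close> under \<open>w \<mapsto> B\<^sup>T log \<bar>w\<bar>\<close>, and this map is invariant under scaling by positive
  factors. It is therefore a curve, parametrized by a (possibly empty) open interval of points \<open>w = B (p + t q)\<close>. The
  derivative of its \<open>q\<close>-coordinate is the value at \<open>B q\<close> of the form \<open>\<Sum>i. y i\<^sup>2 / w i\<close>. This form has
  \<open>w\<close> in its radical, so if the derivative vanished, the form would vanish on all relations; then
  \<open>H\<close> would be singular (\<open>radical_spanned_by_relation\<close>). Thus nondegeneracy of the Hessian makes the
  \<open>q\<close>-coordinate injective, and the curve is the graph of a continuous function over an open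
  interval. The complement of such a graph has at most two components, because every point outside
  the vertical strip over the interval can be connected to the region above or the region below the
  graph (\<open>graph_complement_two_connected\<close>).
\<close>

section \<open>Indefinite symmetric matrices of size two\<close>

text \<open>
  Completing the square shows that \<open>a\<close> times the form and \<open>d\<close> times the form are nonnegative. Values
  of both signs force \<open>a\<close> and \<open>d\<close> to vanish, and then \<open>b\<close> vanishes too.
\<close>

lemma semidefinite_binary_form:
  fixes a b d :: real
  assumes "b\<^sup>2 \<le> a * d"
    and neg: "a * x\<^sup>2 + 2 * b * x * y + d * y\<^sup>2 < 0"
    and pos: "a * x'\<^sup>2 + 2 * b * x' * y' + d * y'\<^sup>2 > 0"
  shows False
proof -
  let ?Q = "\<lambda>x y. a * x\<^sup>2 + 2 * b * x * y + d * y\<^sup>2"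
  have "a * ?Q x y = (a * x + b * y)\<^sup>2 + (a * d - b\<^sup>2) * y\<^sup>2"
    and "d * ?Q x y = (b * x + d * y)\<^sup>2 + (a * d - b\<^sup>2) * x\<^sup>2" for x y
    by (simp_all add: power2_eq_square algebra_simps)
  then have same_sign: "a * ?Q x y \<ge> 0" "d * ?Q x y \<ge> 0" for x y
    using assms(1) by simp_all
  have nonpos: "c \<le> 0" if "c * r \<ge> 0" "r < 0" for c r :: real
    using that by (simp add: zero_le_mult_iff)
  have nonneg: "c \<ge> 0" if "c * r \<ge> 0" "r > 0" for c r :: real
    using that by (simp add: zero_le_mult_iff)
  have "a \<le> 0" "d \<le> 0" "a \<ge> 0" "d \<ge> 0"
    using nonpos[OF same_sign(1) neg] nonpos[OF same_sign(2) neg]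
      nonneg[OF same_sign(1) pos] nonneg[OF same_sign(2) pos] .
  then have "a = 0" "d = 0" by simp_all
  moreover from this have "b = 0" using assms(1) by simp
  ultimately show False using neg by simp
qed

lemma det_neg_if_indefinite:
  fixes H :: "real^2^2"
  assumes "transpose H = H" and "u \<bullet> (H *v u) < 0" and "v \<bullet> (H *v v) > 0"
  shows "det H < 0"
proof (rule ccontr)
  have sym: "H $ 2 $ 1 = H $ 1 $ 2"
    using arg_cong[OF assms(1), of "\<lambda>M. M $ 1 $ 2"] by (simp add: transpose_def)
  have form: "x \<bullet> (H *v x) = H $ 1 $ 1 * (x $ 1)\<^sup>2 + 2 * H $ 1 $ 2 * x $ 1 * x $ 2 + H $ 2 $ 2 * (x $ 2)\<^sup>2"
    for x :: "real^2"
    by (simp add: inner_vec_def matrix_vector_mult_def sum_2 sym power2_eq_square algebra_simps)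
  assume "\<not> det H < 0"
  then have "(H $ 1 $ 2)\<^sup>2 \<le> H $ 1 $ 1 * H $ 2 $ 2"
    by (simp add: det_2 sym power2_eq_square)
  then show False
    using semidefinite_binary_form assms(2,3) unfolding form by blast
qed

lemma eigenvalue_if_det_zero:
  fixes H :: "real^'n::finite^'n"
  assumes "det (H - mat l) = 0"
  shows "eigenvalue H l"
proof -
  have "\<not> invertible (H - mat l)"
    using assms by (simp add: invertible_det_nz)
  then obtain v where "v \<noteq> 0" "(H - mat l) *v v = 0"
    by (metis invertible_left_inverse matrix_left_invertible_ker)
  moreover have "(mat l :: real^'n^'n) *v v = l *\<^sub>R v"
    by (simp add: vec_eq_iff matrix_vector_mult_def mat_def if_distrib if_distribR cong: if_cong)
  ultimately show ?thesis
    unfolding eigenvalue_def by (auto simp: matrix_vector_mult_diff_rdistrib)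
qed

text \<open>
  The determinant is the product of the two roots of the characteristic polynomial; if it is
  negative, the roots are real and have opposite signs.
\<close>

lemma eigenvalues_if_det_neg:
  fixes H :: "real^2^2"
  assumes "det H < 0"
  shows "\<exists>l>0. eigenvalue H l" and "\<exists>l<0. eigenvalue H l"
proof -
  define \<tau> where "\<tau> = H $ 1 $ 1 + H $ 2 $ 2"
  define s where "s = sqrt (\<tau>\<^sup>2 - 4 * det H)"
  have s2: "s\<^sup>2 = \<tau>\<^sup>2 - 4 * det H"
    using assms unfolding s_def by (intro real_sqrt_pow2) (smt (verit) zero_le_power2)
  have "\<bar>\<tau>\<bar> < s"
    unfolding s_def using assms by (intro real_less_rsqrt) simp
  then have pos: "(\<tau> + s) / 2 > 0" and neg: "(\<tau> - s) / 2 < 0"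
    by auto
  have char: "det (H - mat l) = l\<^sup>2 - \<tau> * l + det H" for l
    by (simp add: det_2 mat_def \<tau>_def power2_eq_square algebra_simps)
  have root: "l\<^sup>2 - \<tau> * l + det H = 0" if "l = (\<tau> + s) / 2 \<or> l = (\<tau> - s) / 2" for l
  proof -
    have "2 * l - \<tau> = s \<or> 2 * l - \<tau> = - s" using that by auto
    then have "(2 * l - \<tau>)\<^sup>2 = s\<^sup>2" by (auto simp del: minus_diff_eq)
    then show ?thesis unfolding s2 by (simp add: power2_eq_square algebra_simps)
  qed
  show "\<exists>l>0. eigenvalue H l"
    using pos root[of "(\<tau> + s) / 2"] by (intro exI[of _ "(\<tau> + s) / 2"]) (simp add: eigenvalue_if_det_zero char)
  show "\<exists>l<0. eigenvalue H l"
    using neg root[of "(\<tau> - s) / 2"] by (intro exI[of _ "(\<tau> - s) / 2"]) (simp add: eigenvalue_if_det_zero char)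
qed


section \<open>Affine relations and their moment matrices\<close>

text \<open>
  If \<open>x\<close> is a singular point of an exponential sum, then its terms \<open>c i * exp (\<alpha> i \<bullet> x)\<close> form an affine
  relation, and the Hessian at \<open>x\<close> is the second moment matrix of that relation.
\<close>

definition affine_relation :: "('m::finite \<Rightarrow> real^'n::finite) \<Rightarrow> real^'m \<Rightarrow> bool" where
  "affine_relation \<alpha> w \<longleftrightarrow> (\<Sum>i\<in>UNIV. w $ i) = 0 \<and> (\<Sum>i\<in>UNIV. w $ i *\<^sub>R \<alpha> i) = 0"

definition second_moment :: "('m::finite \<Rightarrow> real^'n::finite) \<Rightarrow> real^'m \<Rightarrow> real^'n^'n" where
  "second_moment \<alpha> w = (\<chi> a b. \<Sum>i\<in>UNIV. w $ i * \<alpha> i $ a * \<alpha> i $ b)"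

definition exp_terms :: "('m::finite \<Rightarrow> real^'n::finite) \<Rightarrow> real^'m \<Rightarrow> real^'n \<Rightarrow> real^'m" where
  "exp_terms \<alpha> c x = (\<chi> i. c $ i * exp (\<alpha> i \<bullet> x))"

lemma A_hat_kernel_iff: "A_hat \<alpha> *v w = 0 \<longleftrightarrow> affine_relation \<alpha> w"
proof -
  have "(A_hat \<alpha> *v w) $ None = (\<Sum>i\<in>UNIV. w $ i)"
    by (simp add: A_hat_def matrix_vector_mult_def)
  moreover have "(A_hat \<alpha> *v w) $ Some j = (\<Sum>i\<in>UNIV. w $ i *\<^sub>R \<alpha> i) $ j" for j
    by (simp add: A_hat_def matrix_vector_mult_def mult.commute)
  ultimately show ?thesis
    unfolding affine_relation_def vec_eq_iff by (simp add: split_option_all) 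
qed

lemma affine_relation_inner:
  assumes "affine_relation \<alpha> w"
  shows "(\<Sum>i\<in>UNIV. w $ i * (v \<bullet> \<alpha> i)) = 0"
proof -
  have "(\<Sum>i\<in>UNIV. w $ i * (v \<bullet> \<alpha> i)) = v \<bullet> (\<Sum>i\<in>UNIV. w $ i *\<^sub>R \<alpha> i)"
    by (simp add: inner_sum_right)
  then show ?thesis using assms by (simp add: affine_relation_def)
qed

lemma second_moment_symmetric: "transpose (second_moment \<alpha> w) = second_moment \<alpha> w"
  by (simp add: second_moment_def transpose_def vec_eq_iff mult.assoc mult.commute mult.left_commute)

lemma second_moment_mult:
  "second_moment \<alpha> w *v v = (\<Sum>i\<in>UNIV. (w $ i * (v \<bullet> \<alpha> i)) *\<^sub>R \<alpha> i)"
proof (rule vec_eq_iff[THEN iffD2, rule_format])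
  fix a
  have "(second_moment \<alpha> w *v v) $ a = (\<Sum>b\<in>UNIV. \<Sum>i\<in>UNIV. w $ i * \<alpha> i $ a * \<alpha> i $ b * v $ b)"
    by (simp add: second_moment_def matrix_vector_mult_def sum_distrib_right)
  also have "\<dots> = (\<Sum>i\<in>UNIV. \<Sum>b\<in>UNIV. w $ i * \<alpha> i $ a * \<alpha> i $ b * v $ b)"
    by (rule sum.swap)
  also have "\<dots> = (\<Sum>i\<in>UNIV. (w $ i * (v \<bullet> \<alpha> i)) *\<^sub>R \<alpha> i) $ a"
    by (simp add: inner_vec_def sum_distrib_left sum_distrib_right mult_ac)
  finally show "(second_moment \<alpha> w *v v) $ a = (\<Sum>i\<in>UNIV. (w $ i * (v \<bullet> \<alpha> i)) *\<^sub>R \<alpha> i) $ a" .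
qed

lemma second_moment_form:
  "v \<bullet> (second_moment \<alpha> w *v v) = (\<Sum>i\<in>UNIV. w $ i * (v \<bullet> \<alpha> i)\<^sup>2)"
  by (simp add: second_moment_mult inner_sum_right power2_eq_square mult.assoc)

text \<open>
  On an affine relation the square \<open>(v \<bullet> \<alpha> i)\<^sup>2\<close> may be replaced by \<open>(v \<bullet> \<alpha> i - a) * (v \<bullet> \<alpha> i - b)\<close>,
  since the two differ by an affine function of \<open>\<alpha> i\<close>. For enclosing hyperplanes of the positive
  points, that product is nonpositive on positive and nonnegative on negative points.
\<close>

lemma second_moment_neg_if_enclosing:
  assumes rel: "affine_relation \<alpha> w" and sgn: "\<And>i. sgn (w $ i) = \<epsilon> i"
    and \<epsilon>: "\<And>i. \<epsilon> i \<in> {-1, 1}"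
    and enc: "strict_enclosing_hyperplanes v a b (pos_support \<alpha> \<epsilon>) (neg_support \<alpha> \<epsilon>)"
  shows "v \<bullet> (second_moment \<alpha> w *v v) < 0"
proof -
  have v: "v \<noteq> 0" and "b \<le> a"
    using enc by (auto simp: strict_enclosing_hyperplanes_def enclosing_hyperplanes_def)
  have interiors: "interior (halfspace_le v s) = {\<mu>. v \<bullet> \<mu> < s}" "interior (halfspace_ge v s) = {\<mu>. v \<bullet> \<mu> > s}"
    for s
    using v by (simp_all add: halfspace_le_def halfspace_ge_def)
  have pos: "b \<le> v \<bullet> \<alpha> i \<and> v \<bullet> \<alpha> i \<le> a" if "\<epsilon> i = 1" for i
    using enc that
    by (auto simp: strict_enclosing_hyperplanes_def enclosing_hyperplanes_def pos_support_def
        halfspace_le_def halfspace_ge_def)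
  have neg: "v \<bullet> \<alpha> i \<ge> a \<or> v \<bullet> \<alpha> i \<le> b" if "\<epsilon> i = -1" for i
  proof -
    have "\<alpha> i \<in> neg_support \<alpha> \<epsilon>" using that by (auto simp: neg_support_def)
    then have "\<alpha> i \<notin> interior (halfspace_le v a) \<inter> interior (halfspace_ge v b)"
      using enc by (auto simp: strict_enclosing_hyperplanes_def enclosing_hyperplanes_def)
    then show ?thesis unfolding interiors by auto
  qed
  obtain j where j: "\<epsilon> j = -1" "v \<bullet> \<alpha> j > a"
    using enc unfolding strict_enclosing_hyperplanes_def interiors
    by (auto simp: neg_support_def)
  have term_le: "w $ i * ((v \<bullet> \<alpha> i - a) * (v \<bullet> \<alpha> i - b)) \<le> 0" for i
  proof (cases "\<epsilon> i = 1")
    case True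
    then have "w $ i > 0" using sgn[of i] by (simp add: sgn_1_pos)
    then show ?thesis using pos[OF True]
      by (intro mult_nonneg_nonpos mult_nonpos_nonneg) auto
  next
    case False
    then have i: "\<epsilon> i = -1" using \<epsilon>[of i] by auto
    then have "w $ i < 0" using sgn[of i] by (simp add: sgn_1_neg)
    moreover have "(v \<bullet> \<alpha> i - a) * (v \<bullet> \<alpha> i - b) \<ge> 0"
      using neg[OF i] \<open>b \<le> a\<close> by (auto intro: mult_nonneg_nonneg mult_nonpos_nonpos)
    ultimately show ?thesis by (intro mult_nonpos_nonneg) auto
  qed
  have "w $ j < 0" using j sgn[of j] by (simp add: sgn_1_neg)
  then have term_less: "w $ j * ((v \<bullet> \<alpha> j - a) * (v \<bullet> \<alpha> j - b)) < 0"
    using j \<open>b \<le> a\<close> by (intro mult_neg_pos mult_pos_pos) auto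
  have "v \<bullet> (second_moment \<alpha> w *v v) =
      (\<Sum>i\<in>UNIV. w $ i * ((v \<bullet> \<alpha> i - a) * (v \<bullet> \<alpha> i - b)))
      + (a + b) * (\<Sum>i\<in>UNIV. w $ i * (v \<bullet> \<alpha> i)) - a * b * (\<Sum>i\<in>UNIV. w $ i)"
    unfolding second_moment_form sum_distrib_left sum.distrib[symmetric] sum_subtractf[symmetric]
    by (intro sum.cong) (auto simp: power2_eq_square algebra_simps)
  also have "\<dots> = (\<Sum>i\<in>UNIV. w $ i * ((v \<bullet> \<alpha> i - a) * (v \<bullet> \<alpha> i - b)))"
    using rel affine_relation_inner[OF rel, of v] by (simp add: affine_relation_def)
  also have "\<dots> < (\<Sum>i\<in>(UNIV::'a set). 0)"
    by (rule sum_strict_mono_ex1) (use term_le term_less in auto)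
  finally show ?thesis by simp
qed

lemma second_moment_det_neg:
  fixes \<alpha> :: "'m::finite \<Rightarrow> real^2"
  assumes "signed_support \<alpha> \<epsilon>"
    and pos: "\<exists>v a b. strict_enclosing_hyperplanes v a b (pos_support \<alpha> \<epsilon>) (neg_support \<alpha> \<epsilon>)"
    and neg: "\<exists>v a b. strict_enclosing_hyperplanes v a b (neg_support \<alpha> \<epsilon>) (pos_support \<alpha> \<epsilon>)"
    and rel: "affine_relation \<alpha> w" and w: "w \<in> coeff_orthant \<epsilon>"
  shows "det (second_moment \<alpha> w) < 0"
proof -
  have \<epsilon>: "\<epsilon> i \<in> {-1, 1}" for i using assms(1) by (simp add: signed_support_def)
  have sgn: "sgn (w $ i) = \<epsilon> i" for i using w by (simp add: coeff_orthant_def)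
  obtain u where u: "u \<bullet> (second_moment \<alpha> w *v u) < 0"
    using second_moment_neg_if_enclosing[OF rel sgn \<epsilon>] pos by blast
  have swap: "pos_support \<alpha> (\<lambda>i. - \<epsilon> i) = neg_support \<alpha> \<epsilon>" "neg_support \<alpha> (\<lambda>i. - \<epsilon> i) = pos_support \<alpha> \<epsilon>"
    by (simp_all add: pos_support_def neg_support_def minus_equation_iff[of _ 1] eq_commute[of "-1"])
  have rel': "affine_relation \<alpha> (- w)"
    using rel by (simp add: affine_relation_def sum_negf)
  have "\<exists>v. v \<bullet> (second_moment \<alpha> (- w) *v v) < 0"
    using second_moment_neg_if_enclosing[OF rel', where \<epsilon> = "\<lambda>i. - \<epsilon> i"] neg sgn \<epsilon>
    unfolding swap by (fastforce simp: sgn_minus)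
  then obtain v where "v \<bullet> (second_moment \<alpha> w *v v) > 0"
    by (auto simp: second_moment_form sum_negf)
  with u show ?thesis
    by (intro det_neg_if_indefinite second_moment_symmetric)
qed

lemma partial_deriv_exp_sum:
  "partial_deriv j (exp_sum \<alpha> c) = exp_sum \<alpha> (\<chi> i. c $ i * \<alpha> i $ j)"
proof
  fix x
  have "((\<lambda>t. exp_sum \<alpha> c (x + t *\<^sub>R axis j 1)) has_field_derivative
      (\<Sum>i\<in>UNIV. c $ i * (exp (\<alpha> i \<bullet> x) * \<alpha> i $ j))) (at 0)"
    unfolding exp_sum_def inner_add_right inner_scaleR_right
    by (auto intro!: derivative_eq_intros sum.cong simp: inner_axis)
  then show "partial_deriv j (exp_sum \<alpha> c) x = exp_sum \<alpha> (\<chi> i. c $ i * \<alpha> i $ j) x"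
    unfolding partial_deriv_def by (simp add: DERIV_imp_deriv exp_sum_def mult_ac)
qed

lemma hessian_exp_sum: "hessian (exp_sum \<alpha> c) x = second_moment \<alpha> (exp_terms \<alpha> c x)"
  unfolding hessian_def second_moment_def partial_deriv_exp_sum vec_eq_iff
  by (simp add: exp_sum_def exp_terms_def mult_ac)

lemma sing_exp_sum_iff: "x \<in> sing (exp_sum \<alpha> c) \<longleftrightarrow> affine_relation \<alpha> (exp_terms \<alpha> c x)"
  unfolding sing_def affine_relation_def partial_deriv_exp_sum vec_eq_iff
  by (simp add: exp_sum_def exp_terms_def mult_ac)

lemma exp_terms_in_coeff_orthant:
  "c \<in> coeff_orthant \<epsilon> \<Longrightarrow> exp_terms \<alpha> c x \<in> coeff_orthant \<epsilon>"
  by (simp add: coeff_orthant_def exp_terms_def sgn_mult)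


section \<open>Nondegeneracy on the space of affine relations\<close>

text \<open>
  The vectors orthogonal to all affine relations are the restrictions of affine functions to the
  support, because the kernel of a matrix is the orthogonal complement of its row space.
\<close>

lemma orthogonal_to_affine_relations:
  assumes "\<And>y. affine_relation \<alpha> y \<Longrightarrow> (\<Sum>i\<in>UNIV. r $ i * y $ i) = 0"
  obtains a v where "\<And>i. r $ i = a + v \<bullet> \<alpha> i"
proof -
  let ?A = "A_hat \<alpha>"
  have sub: "subspace (range (\<lambda>x. transpose ?A *v x))"
    by (intro linear_subspace_image matrix_vector_mul_linear subspace_UNIV)
  have "r \<in> orthogonal_comp ((\<lambda>w. ?A *v w) -` {0})"
    using assms by (auto simp: orthogonal_comp_def orthogonal_def A_hat_kernel_iff inner_vec_def mult.commute)
  also have "\<dots> = range (\<lambda>x. transpose ?A *v x)"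
    by (simp add: ker_orthogonal_comp_adjoint adjoint_matrix orthogonal_comp_self[OF sub]
        del: transpose_matrix_vector)
  finally obtain x where x: "r = transpose ?A *v x" by auto
  have "r $ i = x $ None + (\<chi> j. x $ Some j) \<bullet> \<alpha> i" for i
    unfolding x
    by (simp add: matrix_vector_mult_def transpose_def A_hat_def inner_vec_def UNIV_option_conv
        sum.reindex mult.commute)
  then show thesis using that by blast
qed

text \<open>
  The quadratic form \<open>\<Sum>i. y i\<^sup>2 / w i\<close> on affine relations always has \<open>w\<close> in its radical. A further
  element \<open>u\<close> of the radical gives an affine function \<open>u / w\<close> on the support, whose linear part lies
  in the kernel of the second moment matrix. If that matrix is nonsingular, then \<open>u / w\<close> is constant.
\<close>

lemma radical_spanned_by_relation:
  assumes w: "affine_relation \<alpha> w" "\<And>i. w $ i \<noteq> 0"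
    and u: "affine_relation \<alpha> u"
    and radical: "\<And>y. affine_relation \<alpha> y \<Longrightarrow> (\<Sum>i\<in>UNIV. u $ i / w $ i * y $ i) = 0"
    and nondeg: "det (second_moment \<alpha> w) \<noteq> 0"
  obtains a where "u = a *\<^sub>R w"
proof -
  obtain a v where av: "\<And>i. (\<chi> i. u $ i / w $ i) $ i = a + v \<bullet> \<alpha> i"
    using orthogonal_to_affine_relations[of \<alpha> "\<chi> i. u $ i / w $ i"] radical by auto
  have coeff: "w $ i * (v \<bullet> \<alpha> i) = u $ i - a * w $ i" for i
    using av[of i] w(2)[of i] by (simp add: field_simps)
  have "second_moment \<alpha> w *v v = (\<Sum>i\<in>UNIV. u $ i *\<^sub>R \<alpha> i) - a *\<^sub>R (\<Sum>i\<in>UNIV. w $ i *\<^sub>R \<alpha> i)"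
    unfolding second_moment_mult coeff
    by (simp add: scaleR_left_diff_distrib sum_subtractf scaleR_sum_right)
  also have "\<dots> = 0"
    using u w by (simp add: affine_relation_def)
  finally have "v = 0"
    using nondeg by (metis invertible_det_nz invertible_left_inverse matrix_left_invertible_ker)
  then have "u = a *\<^sub>R w"
    using coeff by (subst vec_eq_iff) simp
  then show thesis by (rule that)
qed


section \<open>The complement of a graph over an open interval\<close>

text \<open>
  The point \<open>p\<close> is the endpoint of \<open>J\<close> on the side of \<open>x\<close>; openness of \<open>J\<close> keeps it outside \<open>J\<close>.
\<close>

lemma outside_point_joins_closure:
  fixes J :: "real set"
  assumes J: "open J" "connected J" "J \<noteq> {}" and x: "x \<notin> J"
  obtains p where "p \<in> closure J" and "closed_segment x p \<inter> J = {}"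
proof -
  have iv: "is_interval J" using J(2) is_interval_connected_1 by blast
  have no: "\<not> (\<exists>a\<in>J. \<exists>b\<in>J. a \<le> x \<and> x \<le> b)"
    using iv x unfolding is_interval_1 by blast
  consider "\<And>j. j \<in> J \<Longrightarrow> j < x" | "\<And>j. j \<in> J \<Longrightarrow> x < j"
    using no by (meson linorder_not_le)
  then show thesis
  proof cases
    case 1
    then have bdd: "bdd_above J" by (meson bdd_aboveI less_imp_le)
    have "Sup J \<le> x" using J(3) by (intro cSup_least) (auto intro: less_imp_le 1)
    moreover have less: "j < Sup J" if j: "j \<in> J" for j
    proof -
      obtain e where "e > 0" "ball j e \<subseteq> J" using openE[OF J(1) j] by blast
      then have "j + e / 2 \<in> J" using subsetD[of "ball j e" J "j + e / 2"] by (simp add: dist_real_def)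
      then show ?thesis using cSup_upper[OF _ bdd, of "j + e / 2"] \<open>e > 0\<close> by auto
    qed
    ultimately show thesis
      using closure_contains_Sup[OF J(3) bdd]
      by (intro that[of "Sup J"]) (auto simp: closed_segment_eq_real_ivl dest: less)
  next
    case 2
    then have bdd: "bdd_below J" by (meson bdd_belowI less_imp_le)
    have "x \<le> Inf J" using J(3) by (intro cInf_greatest) (auto intro: less_imp_le 2)
    moreover have less: "Inf J < j" if j: "j \<in> J" for j
    proof -
      obtain e where "e > 0" "ball j e \<subseteq> J" using openE[OF J(1) j] by blast
      then have "j - e / 2 \<in> J" using subsetD[of "ball j e" J "j - e / 2"] by (simp add: dist_real_def)
      then show ?thesis using cInf_lower[OF _ bdd, of "j - e / 2"] \<open>e > 0\<close> by auto
    qed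
    ultimately show thesis
      using closure_contains_Inf[OF J(3) bdd]
      by (intro that[of "Inf J"]) (auto simp: closed_segment_eq_real_ivl dest: less)
  qed
qed

text \<open>
  The regions above and below the curve are connected. A point whose first coordinate is outside the
  interval \<open>X ` T\<close> is joined inside a vertical strip to the points \<open>(p, 1)\<close> and \<open>(p, - 1)\<close> over an
  endpoint \<open>p\<close> of that interval. As \<open>X t\<close> approaches \<open>p\<close>, the second coordinate is infinitely often at
  most \<open>0\<close> or infinitely often at least \<open>0\<close>. In the first case \<open>(p, 1)\<close> is a limit of points above the
  curve, in the second case \<open>(p, - 1)\<close> is a limit of points below it.
\<close>

lemma graph_complement_two_connected:
  fixes X Y :: "real \<Rightarrow> real"
  assumes T: "open T" "connected T"
    and X: "continuous_on T X" "inj_on X T" and Y: "continuous_on T Y"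
  obtains A B where "connected A" "connected B" "- (\<lambda>t. (X t, Y t)) ` T = A \<union> B"
proof (cases "T = {}")
  case True
  then show thesis using that[of UNIV UNIV] by (simp add: connected_UNIV)
next
  case False
  then obtain t0 where t0: "t0 \<in> T" by auto
  let ?J = "X ` T"
  define S where "S = - (\<lambda>t. (X t, Y t)) ` T"
  \<comment> \<open>The sign \<open>s = 1\<close> gives the points above the curve, \<open>s = - 1\<close> those below it.\<close>
  define region where "region s = (\<lambda>(t, r). (X t, Y t + s * r)) ` (T \<times> {0<..})" for s :: real
  have J: "open ?J" "connected ?J" "?J \<noteq> {}"
    using T X t0 by (auto simp: invariance_of_domain connected_continuous_image)
  have region_connected: "connected (region s)" for s
    unfolding region_def
  proof (rule connected_continuous_image)
    show "connected (T \<times> {0::real<..})" using T(2) by (intro connected_Times) auto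
    show "continuous_on (T \<times> {0<..}) (\<lambda>(t, r). (X t, Y t + s * r))"
      unfolding case_prod_unfold
      by (intro continuous_intros continuous_on_compose2[OF X(1)] continuous_on_compose2[OF Y]) auto
  qed
  have region_sub: "region s \<subseteq> S" if "s \<noteq> 0" for s
  proof (clarsimp simp: region_def S_def)
    fix t r t' assume "t \<in> T" "t' \<in> T" "X t = X t'" "0 < r" "Y t + s * r = Y t'"
    then show False using inj_onD[OF X(2), of t t'] that by simp
  qed
  have regionI: "(X t, y) \<in> region s" if "t \<in> T" "s * s = 1" "(y - Y t) * s > 0" for t y s
    unfolding region_def
  proof (rule image_eqI[of _ _ "(t, (y - Y t) * s)"])
    show "(X t, y) = (\<lambda>(t, r). (X t, Y t + s * r)) (t, (y - Y t) * s)"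
      using that(2) by (simp add: algebra_simps mult.assoc[symmetric])
  qed (use that in auto)
  define base where "base s = (X t0, Y t0 + s)" for s
  have base: "base s \<in> region s" if "s * s = 1" for s
    unfolding base_def using that t0 by (intro regionI) auto
  have covered: "\<exists>s\<in>{1, -1}. z \<in> connected_component_set S (base s)" if "z \<in> S" for z
  proof -
    obtain x y where z: "z = (x, y)" by (cases z)
    have "\<exists>s\<in>{1, -1::real}. \<exists>C. connected C \<and> C \<subseteq> S \<and> z \<in> C \<and> base s \<in> C"
    proof (cases "x \<in> ?J")
      case True
      then obtain t where t: "t \<in> T" "x = X t" by auto
      with that have "y \<noteq> Y t" by (auto simp: z S_def)
      define s :: real where "s = sgn (y - Y t)"
      have s: "s \<in> {1, -1}" "(y - Y t) * s > 0"
        using \<open>y \<noteq> Y t\<close> unfolding s_def by (auto simp: sgn_if)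
      then have "s * s = 1" "s \<noteq> 0" by auto
      then have "z \<in> region s" unfolding z t(2) using t(1) s by (intro regionI)
      then show ?thesis
        using s(1) region_connected region_sub[OF \<open>s \<noteq> 0\<close>] base[OF \<open>s * s = 1\<close>] by blast
    next
      case False
      obtain p where p: "p \<in> closure ?J" "closed_segment x p \<inter> ?J = {}"
        using outside_point_joins_closure[OF J False] .
      let ?strip = "closed_segment x p \<times> (UNIV :: real set)"
      have strip: "connected ?strip" "?strip \<subseteq> S" "z \<in> ?strip"
        using p(2) by (auto simp: S_def z connected_Times)
      have "?J = (\<Union>s\<in>{1, -1}. X ` {t\<in>T. s * Y t \<le> 0})"
        using linear[of "Y _" 0] by force
      then have "closure ?J = (\<Union>s\<in>{1, -1}. closure (X ` {t\<in>T. s * Y t \<le> 0}))"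
        by (simp add: closure_Un del: mult_minus_left)
      then obtain s :: real where s: "s \<in> {1, -1}" "p \<in> closure (X ` {t\<in>T. s * Y t \<le> 0})"
        using p(1) by blast
      then have ss: "s * s = 1" "s \<noteq> 0" by auto
      have "(p, s) \<in> closure (X ` {t\<in>T. s * Y t \<le> 0} \<times> {s})"
        using s(2) by (simp add: closure_Times)
      moreover have "X ` {t\<in>T. s * Y t \<le> 0} \<times> {s} \<subseteq> region s"
        using ss by (auto intro!: regionI simp: algebra_simps)
      ultimately have "(p, s) \<in> closure (region s)"
        using closure_mono by blast
      then have "connected (insert (p, s) (region s))"
        by (intro connected_intermediate_closure[OF region_connected[of s]]) (auto intro: closure_subset[THEN subsetD])
      moreover have "(p, s) \<in> ?strip" by simp
      ultimately have "connected (?strip \<union> insert (p, s) (region s))"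
        using strip(1) by (intro connected_Un) blast+
      moreover have "?strip \<union> insert (p, s) (region s) \<subseteq> S"
        using strip(2) \<open>(p, s) \<in> ?strip\<close> region_sub[OF ss(2)] by blast
      ultimately show ?thesis
        using s(1) strip(3) base[OF ss(1)] by blast
    qed
    then show ?thesis by (auto simp: connected_component_def)
  qed
  show thesis
  proof (rule that)
    show "- (\<lambda>t. (X t, Y t)) ` T = connected_component_set S (base 1) \<union> connected_component_set S (base (-1))"
      using covered connected_component_subset[of S] unfolding S_def[symmetric] by blast
  qed (rule connected_connected_component)+
qed

lemma components_le_2_if_union:
  assumes "connected A" "connected B"
  shows "finite (components (A \<union> B)) \<and> card (components (A \<union> B)) \<le> 2"
proof -
  define rep where "rep D = (SOME d. d \<in> D)" for D :: "'a set"
  have "components (A \<union> B) \<subseteq> (\<lambda>D. connected_component_set (A \<union> B) (rep D)) ` {A, B}"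
  proof
    fix C assume "C \<in> components (A \<union> B)"
    then obtain z where z: "z \<in> A \<union> B" "C = connected_component_set (A \<union> B) z"
      by (auto simp: components_def)
    then obtain D where D: "D \<in> {A, B}" "z \<in> D" by blast
    then have "rep D \<in> D" unfolding rep_def by (metis someI)
    then have "connected_component (A \<union> B) z (rep D)"
      unfolding connected_component_def using D assms by blast
    then have "C = connected_component_set (A \<union> B) (rep D)"
      unfolding z(2) by (intro connected_component_eq[symmetric]) simp
    then show "C \<in> (\<lambda>D. connected_component_set (A \<union> B) (rep D)) ` {A, B}" using D by blast
  qed
  moreover have "card ((\<lambda>D. connected_component_set (A \<union> B) (rep D)) ` {A, B}) \<le> 2"
    by (rule order_trans[OF card_image_le]) (auto simp: card_insert_le_m1)
  ultimately show ?thesis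
    by (meson card_mono finite.emptyI finite.insertI finite_imageI finite_subset le_trans)
qed


section \<open>The signed reduced discriminant as a curve\<close>

lemma gale_dual_affine_relation_iff:
  assumes "gale_dual \<alpha> B"
  shows "affine_relation \<alpha> w \<longleftrightarrow> (\<exists>l. w = B *v l)"
proof -
  have span: "span (columns B) = {w. affine_relation \<alpha> w}"
    using assms by (simp add: gale_dual_def A_hat_kernel_iff)
  have "columns B \<subseteq> range ((*v) B)"
    by (auto simp: columns_def matrix_vector_mult_basis[symmetric])
  then have "span (columns B) \<subseteq> range ((*v) B)"
    by (intro span_minimal linear_subspace_image matrix_vector_mul_linear subspace_UNIV)
  moreover have "range ((*v) B) \<subseteq> span (columns B)"
    using matrix_vector_mult_in_columnspace by blast
  ultimately have "affine_relation \<alpha> w \<longleftrightarrow> w \<in> range ((*v) B)"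
    using span by (metis mem_Collect_eq subset_antisym)
  then show ?thesis by (simp add: image_iff)
qed

lemma gale_dual_inj:
  fixes B :: "real^'k::finite^'m::finite"
  assumes "gale_dual \<alpha> B"
  shows "inj ((*v) B)"
proof -
  have "columns B = range (\<lambda>j. column j B)" by (auto simp: columns_def)
  then have "card (columns B) = CARD('k)"
    using assms by (simp add: gale_dual_def card_image)
  moreover have "independent (columns B)"
    using assms by (simp add: gale_dual_def)
  ultimately show ?thesis
    by (simp add: full_rank_injective[symmetric] column_rank_def dim_eq_card_independent)
qed

lemma inner_transpose_mult:
  fixes B :: "real^'k::finite^'m::finite"
  shows "z \<bullet> (transpose B *v y) = (B *v z) \<bullet> y"
  by (metis dot_lmul_matrix inner_commute transpose_matrix_vector)

lemma log_abs_exp_terms: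
  assumes "affine_relation \<alpha> u" and "\<And>i. c $ i \<noteq> 0"
  shows "u \<bullet> log_abs (exp_terms \<alpha> c x) = u \<bullet> log_abs c"
proof -
  have "u \<bullet> log_abs (exp_terms \<alpha> c x) = (\<Sum>i\<in>UNIV. u $ i * (ln \<bar>c $ i\<bar> + x \<bullet> \<alpha> i))"
    unfolding inner_vec_def using assms(2)
    by (intro sum.cong) (auto simp: log_abs_def exp_terms_def abs_mult ln_mult inner_vec_def mult.commute)
  also have "\<dots> = u \<bullet> log_abs c + (\<Sum>i\<in>UNIV. u $ i * (x \<bullet> \<alpha> i))"
    by (simp add: inner_vec_def log_abs_def distrib_left sum.distrib)
  finally show ?thesis using affine_relation_inner[OF assms(1)] by simp
qed

lemma log_abs_scale:
  assumes "affine_relation \<alpha> u" and "\<And>i. w $ i \<noteq> 0" and "s > 0"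
  shows "u \<bullet> log_abs (s *\<^sub>R w) = u \<bullet> log_abs w"
proof -
  have "u \<bullet> log_abs (s *\<^sub>R w) = (\<Sum>i\<in>UNIV. u $ i * (ln s + ln \<bar>w $ i\<bar>))"
    unfolding inner_vec_def using assms(2,3)
    by (intro sum.cong) (auto simp: log_abs_def abs_mult ln_mult)
  also have "\<dots> = ln s * (\<Sum>i\<in>UNIV. u $ i) + u \<bullet> log_abs w"
    by (simp add: inner_vec_def log_abs_def distrib_left sum.distrib sum_distrib_left mult.commute)
  finally show ?thesis using assms(1) by (simp add: affine_relation_def)
qed

lemma coeff_orthant_nonzero:
  assumes "w \<in> coeff_orthant \<epsilon>" and "\<forall>i. \<epsilon> i \<in> {-1, 1}"
  shows "w $ i \<noteq> 0"
proof
  assume "w $ i = 0"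
  moreover have "sgn (w $ i) = \<epsilon> i" using assms(1) by (simp add: coeff_orthant_def)
  ultimately show False using assms(2) by (auto dest: spec[of _ i])
qed

text \<open>
  Replacing coefficients by the terms at a singular point does not move the image point, so the
  discriminant is parametrized by the affine relations in the orthant: this is the signed form of
  the Horn--Kapranov uniformization.
\<close>

lemma signed_reduced_discriminant_uniformization:
  assumes gale: "gale_dual \<alpha> B" and \<epsilon>: "\<forall>i. \<epsilon> i \<in> {-1, 1}"
  shows "signed_reduced_discriminant \<alpha> \<epsilon> B =
    {transpose B *v log_abs w | w. affine_relation \<alpha> w \<and> w \<in> coeff_orthant \<epsilon>}"
proof (intro set_eqI iffI)
  fix z assume "z \<in> signed_reduced_discriminant \<alpha> \<epsilon> B"
  then obtain c x where c: "c \<in> coeff_orthant \<epsilon>" "x \<in> sing (exp_sum \<alpha> c)" and z: "z = transpose B *v log_abs c"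
    by (auto simp: signed_reduced_discriminant_def signed_discriminant_def)
  have "y \<bullet> (transpose B *v log_abs (exp_terms \<alpha> c x)) = y \<bullet> (transpose B *v log_abs c)" for y
    using gale_dual_affine_relation_iff[OF gale] coeff_orthant_nonzero[OF c(1) \<epsilon>]
    unfolding inner_transpose_mult by (intro log_abs_exp_terms) auto
  then have "z = transpose B *v log_abs (exp_terms \<alpha> c x)"
    unfolding z by (metis vector_eq_ldot)
  then show "z \<in> {transpose B *v log_abs w | w. affine_relation \<alpha> w \<and> w \<in> coeff_orthant \<epsilon>}"
    using c exp_terms_in_coeff_orthant[OF c(1)] unfolding sing_exp_sum_iff by blast
next
  fix z assume "z \<in> {transpose B *v log_abs w | w. affine_relation \<alpha> w \<and> w \<in> coeff_orthant \<epsilon>}"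
  then obtain w where w: "affine_relation \<alpha> w" "w \<in> coeff_orthant \<epsilon>" "z = transpose B *v log_abs w"
    by blast
  have "exp_terms \<alpha> w 0 = w" by (simp add: exp_terms_def vec_eq_iff)
  with w(1) have "0 \<in> sing (exp_sum \<alpha> w)" by (simp add: sing_exp_sum_iff)
  with w show "z \<in> signed_reduced_discriminant \<alpha> \<epsilon> B"
    by (auto simp: signed_reduced_discriminant_def signed_discriminant_def)
qed

lemma orthonormal_pair:
  fixes p :: "'a::euclidean_space"
  assumes "norm p = 1" and "DIM('a) = 2"
  obtains q where "norm q = 1" "p \<bullet> q = 0" "\<And>z. z = (p \<bullet> z) *\<^sub>R p + (q \<bullet> z) *\<^sub>R q"
proof -
  obtain S where S: "p \<in> S" "pairwise orthogonal S" "\<And>x. x \<in> S \<Longrightarrow> norm x = 1"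
      "card S = 2" "span S = UNIV"
    using vector_in_orthonormal_basis[OF assms(1)] assms(2) by metis
  obtain q where q: "S = {p, q}" "p \<noteq> q"
    using S(1,4) by (auto simp: card_2_iff)
  have pq: "p \<bullet> q = 0" and nq: "norm q = 1"
    using S(2,3) q by (auto simp: pairwise_def orthogonal_def)
  have "z = (p \<bullet> z) *\<^sub>R p + (q \<bullet> z) *\<^sub>R q" for z
  proof -
    have "z \<in> span {p, q}" using S(5) q by simp
    then obtain a b where z: "z = a *\<^sub>R p + b *\<^sub>R q"
      by (auto simp: span_insert span_singleton algebra_simps)
    have "p \<bullet> p = 1" "q \<bullet> q = 1" using nq assms(1) by (simp_all add: dot_square_norm)
    then show ?thesis using pq by (simp add: z inner_add_right inner_commute)
  qed
  then show thesis using that nq pq by blast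
qed

text \<open>
  At \<open>w = P + t *\<^sub>R Q\<close> the derivative in \<open>t\<close> is the value at \<open>Q\<close> of the form \<open>\<Sum>i. y i\<^sup>2 / w i\<close>. The
  relation \<open>w\<close> is in the radical of this form, and \<open>w\<close> and \<open>Q\<close> span all relations. So if the
  derivative vanishes, \<open>Q\<close> is in the radical as well and must be a multiple of \<open>w\<close>. Injectivity
  follows from Rolle's theorem.
\<close>

lemma log_coordinate_inj:
  assumes rel: "affine_relation \<alpha> P" "affine_relation \<alpha> Q"
    and spanned: "\<And>y. affine_relation \<alpha> y \<Longrightarrow> \<exists>a b. y = a *\<^sub>R P + b *\<^sub>R Q"
    and indep: "\<And>t a. Q \<noteq> a *\<^sub>R (P + t *\<^sub>R Q)"
    and \<epsilon>: "\<forall>i. \<epsilon> i \<in> {-1, 1}"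
    and nondeg: "\<And>w. affine_relation \<alpha> w \<Longrightarrow> w \<in> coeff_orthant \<epsilon> \<Longrightarrow> det (second_moment \<alpha> w) \<noteq> 0"
    and T: "T = {t. P + t *\<^sub>R Q \<in> coeff_orthant \<epsilon>}" and conn: "connected T"
  shows "inj_on (\<lambda>t. Q \<bullet> log_abs (P + t *\<^sub>R Q)) T"
proof -
  let ?w = "\<lambda>t. P + t *\<^sub>R Q"
  let ?X = "\<lambda>t. Q \<bullet> log_abs (?w t)"
  let ?D = "\<lambda>t. \<Sum>i\<in>UNIV. (Q $ i)\<^sup>2 / ?w t $ i"
  have nz: "?w t $ i \<noteq> 0" if "t \<in> T" for t i
    using coeff_orthant_nonzero[OF _ \<epsilon>] that T by blast
  have w_rel: "affine_relation \<alpha> (?w t)" for t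
    using rel by (simp add: affine_relation_def sum.distrib scaleR_add_left
        flip: sum_distrib_left scaleR_scaleR scaleR_sum_right)
  have deriv: "(?X has_field_derivative ?D t) (at t)" if "t \<in> T" for t
  proof -
    have "((\<lambda>t. ln \<bar>P $ i + t * Q $ i\<bar>) has_field_derivative Q $ i / (P $ i + t * Q $ i)) (at t)" for i
    proof -
      \<comment> \<open>This avoids a case distinction on the sign of \<open>x\<close>; at \<open>0\<close> it relies on \<open>ln 0 = 0\<close>.\<close>
      have "(\<lambda>x. ln \<bar>x\<bar>) = (\<lambda>x::real. ln (x\<^sup>2) / 2)"
      proof
        show "ln \<bar>x\<bar> = ln (x\<^sup>2) / 2" for x :: real
          using ln_realpow[of "\<bar>x\<bar>" 2] by (cases "x = 0") simp_all
      qed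
      moreover have "((\<lambda>x. ln (x\<^sup>2) / 2) has_field_derivative 1 / (P $ i + t * Q $ i)) (at (P $ i + t * Q $ i))"
        using nz[OF that, of i] by (auto intro!: derivative_eq_intros simp: power2_eq_square divide_simps zero_less_mult_iff linorder_neq_iff)
      ultimately have "((\<lambda>x. ln \<bar>x\<bar>) has_field_derivative 1 / (P $ i + t * Q $ i)) (at (P $ i + t * Q $ i))"
        by simp
      moreover have "((\<lambda>t. P $ i + t * Q $ i) has_field_derivative Q $ i) (at t)"
        by (auto intro!: derivative_eq_intros)
      ultimately show ?thesis
        using DERIV_chain2[where f = "\<lambda>x. ln \<bar>x\<bar>" and g = "\<lambda>t. P $ i + t * Q $ i"] by fastforce
    qed
    then have "((\<lambda>t. \<Sum>i\<in>UNIV. Q $ i * ln \<bar>P $ i + t * Q $ i\<bar>) has_field_derivative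
        (\<Sum>i\<in>UNIV. Q $ i * (Q $ i / (P $ i + t * Q $ i)))) (at t)"
      by (intro DERIV_sum DERIV_cmult)
    then show ?thesis
      by (simp add: inner_vec_def log_abs_def power2_eq_square)
  qed
  have nonzero: "?D t \<noteq> 0" if t: "t \<in> T" for t
  proof
    assume D: "?D t = 0"
    have with_w: "(\<Sum>i\<in>UNIV. Q $ i / ?w t $ i * ?w t $ i) = 0"
      using rel(2) nz[OF t] by (simp add: affine_relation_def)
    have with_Q: "(\<Sum>i\<in>UNIV. Q $ i / ?w t $ i * Q $ i) = 0"
      using D by (simp add: power2_eq_square)
    have "(\<Sum>i\<in>UNIV. Q $ i / ?w t $ i * y $ i) = 0" if "affine_relation \<alpha> y" for y
    proof -
      obtain a b where "y = a *\<^sub>R P + b *\<^sub>R Q" using spanned \<open>affine_relation \<alpha> y\<close> by blast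
      then have "y = a *\<^sub>R ?w t + (b - a * t) *\<^sub>R Q" by (simp add: algebra_simps)
      then have "(\<Sum>i\<in>UNIV. Q $ i / ?w t $ i * y $ i) =
          (\<Sum>i\<in>UNIV. a * (Q $ i / ?w t $ i * ?w t $ i) + (b - a * t) * (Q $ i / ?w t $ i * Q $ i))"
        by (intro sum.cong) (simp_all add: distrib_left mult_ac)
      also have "\<dots> = 0"
        unfolding sum.distrib sum_distrib_left[symmetric] with_w with_Q by simp
      finally show ?thesis .
    qed
    then obtain a where "Q = a *\<^sub>R ?w t"
      using radical_spanned_by_relation[OF w_rel nz[OF t] rel(2)] nondeg[OF w_rel] t T by blast
    with indep show False by blast
  qed
  have "?X s \<noteq> ?X t" if st: "s \<in> T" "t \<in> T" "s < t" for s t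
  proof
    assume eq: "?X s = ?X t"
    have sub: "{s..t} \<subseteq> T"
      using conn st by (meson connected_contains_Icc)
    have "\<exists>z>s. z < t \<and> (\<lambda>h. ?D z * h) = (\<lambda>h. 0)"
    proof (rule Rolle_deriv[OF \<open>s < t\<close> eq])
      show "continuous_on {s..t} ?X"
        using DERIV_isCont[OF deriv] sub by (intro continuous_at_imp_continuous_on) blast
      show "(?X has_derivative (\<lambda>h. ?D z * h)) (at z)" if "s < z" "z < t" for z
      proof -
        have "z \<in> T" using sub that by (simp add: subset_eq)
        then show ?thesis using deriv[of z] by (simp add: has_field_derivative_def)
      qed
    qed
    then obtain z where "s < z" "z < t" "?D z * 1 = 0" by metis
    moreover from this have "z \<in> T" using sub by (simp add: subset_eq)
    ultimately show False using nonzero by simp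
  qed
  then show ?thesis by (intro linorder_inj_onI) (auto simp: neq_iff)
qed

text \<open>
  A linear functional positive on the cone of all \<open>l\<close> with \<open>B *v l\<close> in the orthant is given by
  \<open>l \<mapsto> \<Sum>i. \<epsilon> i * (B *v l) i\<close>. Its direction \<open>p\<close> lets every ray of the cone be represented on the line
  \<open>p + t *\<^sub>R q\<close> with \<open>q\<close> orthogonal to \<open>p\<close>, and the \<open>q\<close>-coordinate is injective along this line.
  In the coordinates \<open>(q, p)\<close> the discriminant is therefore a graph over an open interval.
\<close>

lemma discriminant_complement_components:
  fixes \<alpha> :: "'m::finite \<Rightarrow> real^'n::finite" and B :: "real^'k::finite^'m"
  assumes gale: "gale_dual \<alpha> B" and k: "CARD('k) = 2" and \<epsilon>: "\<forall>i. \<epsilon> i \<in> {-1, 1}"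
    and nondeg: "\<And>w. affine_relation \<alpha> w \<Longrightarrow> w \<in> coeff_orthant \<epsilon> \<Longrightarrow> det (second_moment \<alpha> w) \<noteq> 0"
  shows "finite (components (UNIV - signed_reduced_discriminant \<alpha> \<epsilon> B)) \<and>
    card (components (UNIV - signed_reduced_discriminant \<alpha> \<epsilon> B)) \<le> 2"
proof (cases "\<exists>l. B *v l \<in> coeff_orthant \<epsilon>")
  case False
  then have "w \<notin> coeff_orthant \<epsilon>" if "affine_relation \<alpha> w" for w
    using gale_dual_affine_relation_iff[OF gale] that by auto
  then have "signed_reduced_discriminant \<alpha> \<epsilon> B = {}"
    unfolding signed_reduced_discriminant_uniformization[OF gale \<epsilon>] by blast
  then show ?thesis using components_le_2_if_union[of UNIV UNIV] by (simp add: connected_UNIV)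
next
  case True
  then obtain l0 where l0: "B *v l0 \<in> coeff_orthant \<epsilon>" by blast
  \<comment> \<open>On the cone, \<open>\<phi> \<bullet> l\<close> is the sum of the absolute values of the entries of \<open>B *v l\<close>.\<close>
  define \<phi> where "\<phi> = transpose B *v (\<chi> i. \<epsilon> i)"
  have cone: "\<phi> \<bullet> l > 0" if "B *v l \<in> coeff_orthant \<epsilon>" for l
  proof -
    have "\<phi> \<bullet> l = (\<Sum>i\<in>UNIV. (B *v l) $ i * \<epsilon> i)"
      unfolding \<phi>_def inner_commute[of _ l] inner_transpose_mult by (simp add: inner_vec_def)
    also have "\<dots> = (\<Sum>i\<in>UNIV. \<bar>(B *v l) $ i\<bar>)"
      using that by (intro sum.cong) (auto simp: coeff_orthant_def abs_sgn)
    also have "\<dots> > 0"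
      using coeff_orthant_nonzero[OF that \<epsilon>] by (intro sum_pos) auto
    finally show ?thesis .
  qed
  have "\<phi> \<noteq> 0" using cone[OF l0] by auto
  define p where "p = \<phi> /\<^sub>R norm \<phi>"
  have "norm p = 1" using \<open>\<phi> \<noteq> 0\<close> by (simp add: p_def)
  have cone_p: "p \<bullet> l > 0" if "B *v l \<in> coeff_orthant \<epsilon>" for l
    using cone[OF that] \<open>\<phi> \<noteq> 0\<close> by (simp add: p_def)
  obtain q where q: "norm q = 1" "p \<bullet> q = 0" and expand: "\<And>z. z = (p \<bullet> z) *\<^sub>R p + (q \<bullet> z) *\<^sub>R q"
    using orthonormal_pair[OF \<open>norm p = 1\<close>] k by auto
  have pp: "p \<bullet> p = 1" and qq: "q \<bullet> q = 1" and qp: "q \<bullet> p = 0"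
    using q \<open>norm p = 1\<close> by (simp_all add: dot_square_norm inner_commute)
  define P where "P = B *v p"
  define Q where "Q = B *v q"
  define T where "T = {t. P + t *\<^sub>R Q \<in> coeff_orthant \<epsilon>}"
  define X where "X t = Q \<bullet> log_abs (P + t *\<^sub>R Q)" for t
  define Y where "Y t = P \<bullet> log_abs (P + t *\<^sub>R Q)" for t
  have rel: "affine_relation \<alpha> (B *v l)" for l
    using gale_dual_affine_relation_iff[OF gale] by blast
  have line: "B *v (p + t *\<^sub>R q) = P + t *\<^sub>R Q" for t
    by (simp add: P_def Q_def matrix_vector_right_distrib matrix_vector_mult_scaleR)
  have nz: "P $ i + t * Q $ i \<noteq> 0" if "t \<in> T" for t i
    using coeff_orthant_nonzero[OF _ \<epsilon>, of "P + t *\<^sub>R Q"] that by (simp add: T_def)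
  have "sgn r = \<epsilon> i \<longleftrightarrow> 0 < \<epsilon> i * r" for i r
  proof -
    have "\<epsilon> i = -1 \<or> \<epsilon> i = 1" using \<epsilon> by blast
    then show ?thesis by (elim disjE) (simp_all add: sgn_if)
  qed
  moreover have "0 < \<epsilon> i * (P $ i + t * Q $ i) \<longleftrightarrow> (\<epsilon> i * Q $ i) \<bullet> t > - (\<epsilon> i * P $ i)" for i t
    by (simp add: algebra_simps) linarith
  ultimately have "T = (\<Inter>i. {t. (\<epsilon> i * Q $ i) \<bullet> t > - (\<epsilon> i * P $ i)})"
    by (simp add: T_def coeff_orthant_def set_eq_iff)
  then have T: "open T" "connected T"
    by (simp_all only:) (intro open_INT finite ballI open_halfspace_gt,
        intro convex_connected convex_INT convex_halfspace_gt)
  have spanned: "\<exists>a b. y = a *\<^sub>R P + b *\<^sub>R Q" if y: "affine_relation \<alpha> y" for y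
  proof -
    obtain z where z: "y = B *v z"
      using gale_dual_affine_relation_iff[OF gale] y by blast
    have "B *v z = B *v ((p \<bullet> z) *\<^sub>R p + (q \<bullet> z) *\<^sub>R q)"
      by (rule arg_cong[OF expand])
    also have "\<dots> = (p \<bullet> z) *\<^sub>R P + (q \<bullet> z) *\<^sub>R Q"
      by (simp add: P_def Q_def matrix_vector_right_distrib matrix_vector_mult_scaleR)
    finally show ?thesis using z by blast
  qed
  have indep: "Q \<noteq> a *\<^sub>R (P + t *\<^sub>R Q)" for t a
  proof
    assume "Q = a *\<^sub>R (P + t *\<^sub>R Q)"
    then have "B *v q = B *v (a *\<^sub>R (p + t *\<^sub>R q))"
      by (simp add: line[symmetric] Q_def[symmetric] matrix_vector_mult_scaleR)
    then have eq: "q = a *\<^sub>R (p + t *\<^sub>R q)" using gale_dual_inj[OF gale] by (blast dest: injD)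
    from arg_cong[OF eq, of "(\<bullet>) p"] have "a = 0"
      by (simp add: inner_add_right pp q(2))
    with eq q(1) show False by simp
  qed
  have X: "continuous_on T X" and Y: "continuous_on T Y"
    unfolding X_def Y_def inner_vec_def log_abs_def
    by (auto intro!: continuous_intros simp: nz)
  have "inj_on X T"
    unfolding X_def
    by (rule log_coordinate_inj[OF _ _ spanned indep \<epsilon> nondeg T_def T(2)]) (auto simp: P_def Q_def rel)
  then obtain C D where CD: "connected C" "connected D" "- (\<lambda>t. (X t, Y t)) ` T = C \<union> D"
    using graph_complement_two_connected[OF T X _ Y] by blast
  define G where "G = (\<lambda>(x, y). x *\<^sub>R q + y *\<^sub>R p)"
  have G_inv: "G (q \<bullet> z, p \<bullet> z) = z" for z
    using expand[of z] by (simp add: G_def add.commute)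
  have inv_G: "(q \<bullet> G xy, p \<bullet> G xy) = xy" for xy
    by (simp add: G_def case_prod_unfold inner_add_right pp qq qp q(2))
  have G_bij: "bij G"
    by (rule bij_betw_byWitness[where f' = "\<lambda>z. (q \<bullet> z, p \<bullet> z)"]) (use G_inv inv_G in auto)
  have G_curve: "G (X t, Y t) = transpose B *v log_abs (P + t *\<^sub>R Q)" for t
    using G_inv[of "transpose B *v log_abs (P + t *\<^sub>R Q)"]
    unfolding inner_transpose_mult by (simp add: X_def Y_def P_def Q_def)
  have "signed_reduced_discriminant \<alpha> \<epsilon> B = G ` (\<lambda>t. (X t, Y t)) ` T"
  proof (intro set_eqI iffI)
    fix z assume "z \<in> G ` (\<lambda>t. (X t, Y t)) ` T"
    then obtain t where "t \<in> T" "z = transpose B *v log_abs (P + t *\<^sub>R Q)"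
      by (auto simp: G_curve)
    then show "z \<in> signed_reduced_discriminant \<alpha> \<epsilon> B"
      unfolding signed_reduced_discriminant_uniformization[OF gale \<epsilon>] T_def
      using rel[of "p + t *\<^sub>R q"] unfolding line by blast
  next
    fix z assume "z \<in> signed_reduced_discriminant \<alpha> \<epsilon> B"
    then obtain l where l: "B *v l \<in> coeff_orthant \<epsilon>" "z = transpose B *v log_abs (B *v l)"
      unfolding signed_reduced_discriminant_uniformization[OF gale \<epsilon>]
        gale_dual_affine_relation_iff[OF gale] by blast
    define s where "s = p \<bullet> l"
    have "s > 0" using cone_p[OF l(1)] by (simp add: s_def)
    define t where "t = (q \<bullet> l) / s"
    have "l = s *\<^sub>R (p + t *\<^sub>R q)"
      using expand[of l] \<open>s > 0\<close> by (simp add: t_def s_def[symmetric] scaleR_add_right)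
    then have Bl: "B *v l = s *\<^sub>R (P + t *\<^sub>R Q)"
      by (simp add: line[symmetric] matrix_vector_mult_scaleR)
    then have "t \<in> T"
      using l(1) \<open>s > 0\<close> by (simp add: T_def coeff_orthant_def sgn_mult)
    have "y \<bullet> z = y \<bullet> (transpose B *v log_abs (P + t *\<^sub>R Q))" for y
      unfolding l(2) inner_transpose_mult Bl
      using nz[OF \<open>t \<in> T\<close>] \<open>s > 0\<close> by (intro log_abs_scale[OF rel]) auto
    then have "z = G (X t, Y t)"
      unfolding G_curve by (metis vector_eq_ldot)
    then show "z \<in> G ` (\<lambda>t. (X t, Y t)) ` T" using \<open>t \<in> T\<close> by blast
  qed
  then have "UNIV - signed_reduced_discriminant \<alpha> \<epsilon> B = G ` (C \<union> D)"
    using CD(3) bij_image_Compl_eq[OF G_bij] by (metis Compl_eq_Diff_UNIV)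
  moreover have "continuous_on A G" for A
    unfolding G_def case_prod_unfold by (intro continuous_intros)
  then have "connected (G ` C)" "connected (G ` D)"
    using CD by (auto intro: connected_continuous_image)
  ultimately show ?thesis
    using components_le_2_if_union by (metis image_Un)
qed

theorem theorem4p11:
  fixes \<alpha> :: "'m::finite \<Rightarrow> real^2"
    and \<epsilon> :: "'m \<Rightarrow> real"
    and B :: "real^'k::finite^'m"
  assumes "signed_support \<alpha> \<epsilon>"
    and "full_dimensional \<alpha>"
    and "gale_dual \<alpha> B"
    and "\<exists>v a b. strict_enclosing_hyperplanes v a b (pos_support \<alpha> \<epsilon>) (neg_support \<alpha> \<epsilon>)"
    and "\<exists>v a b. strict_enclosing_hyperplanes v a b (neg_support \<alpha> \<epsilon>) (pos_support \<alpha> \<epsilon>)"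
  shows "(\<forall>c \<in> coeff_orthant \<epsilon>. \<forall>x \<in> sing (exp_sum \<alpha> c).
            (\<exists>l > 0. eigenvalue (hessian (exp_sum \<alpha> c) x) l) \<and>
            (\<exists>l < 0. eigenvalue (hessian (exp_sum \<alpha> c) x) l)) \<and>
         (card (range \<alpha>) = 5 \<longrightarrow>
            finite (components (UNIV - signed_reduced_discriminant \<alpha> \<epsilon> B)) \<and>
            card (components (UNIV - signed_reduced_discriminant \<alpha> \<epsilon> B)) \<le> 2)"
proof (intro conjI impI ballI)
  note det_neg = second_moment_det_neg[OF assms(1,4,5)]
  {
    fix c x assume "c \<in> coeff_orthant \<epsilon>" and "x \<in> sing (exp_sum \<alpha> c)"
    then have "det (hessian (exp_sum \<alpha> c) x) < 0"
      unfolding hessian_exp_sum by (intro det_neg exp_terms_in_coeff_orthant) (simp add: sing_exp_sum_iff)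
    then show "\<exists>l>0. eigenvalue (hessian (exp_sum \<alpha> c) x) l" "\<exists>l<0. eigenvalue (hessian (exp_sum \<alpha> c) x) l"
      by (rule eigenvalues_if_det_neg)+
  }
  assume "card (range \<alpha>) = 5"
  then have "CARD('m) = 5"
    using assms(1) by (simp add: signed_support_def card_image)
  then have k: "CARD('k) = 2"
    using assms(3) by (simp add: gale_dual_def)
  have \<epsilon>: "\<forall>i. \<epsilon> i \<in> {-1, 1}" using assms(1) by (simp add: signed_support_def)
  have "det (second_moment \<alpha> w) \<noteq> 0" if "affine_relation \<alpha> w" "w \<in> coeff_orthant \<epsilon>" for w
    using det_neg[OF that] by simp
  from discriminant_complement_components[OF assms(3) k \<epsilon> this]
  show "finite (components (UNIV - signed_reduced_discriminant \<alpha> \<epsilon> B))"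
    and "card (components (UNIV - signed_reduced_discriminant \<alpha> \<epsilon> B)) \<le> 2"
    by blast+
qed

end
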